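(* Let $n\ge 1$ be an integer, let $1\le p_2\le p_1<\infty$, and let $\Psi_1:(0,\infty)\to(0,\infty)$ be a measurable function for which there is a constant $A>0$ such that $\frac{\Psi_1(r)}{r^n}\le A\,\frac{\Psi_1(s)}{s^n}$ for all $0<s\le r$. If $f\in S_{p_1,\Psi_1}$ and, for some measurable function $\Psi_2:(0,\infty)\to(0,\infty)$ and some constant $c>0$, $$\eta_{p_1,\Psi_1}f(r)\le c\,\Psi_1(r)^{1/p_1}\,\Psi_2(r)\quad\text{for every } r>0,$$ then $f\in L^{p_2,\Psi_2}$.
   Context: Let $B(x,r):=\{y\in\mathbb{R}^n:|x-y|<r\}$ and let $|E|$ denote Lebesgue measure. For $1\le p<\infty$ and a measurable function $\Psi:(0,\infty)\to(0,\infty)$: The generalized Morrey space $L^{p,\Psi}=L^{p,\Psi}(\mathbb{R}^n)$ is the set of all $f\in L^p_{\rm loc}(\mathbb{R}^n)$ with $$\|f\|_{L^{p,\Psi}}:=\sup_{x\in\mathbb{R}^n,\,r>0}\frac{|B(x,r)|^{-1/p}}{\Psi(r)}\left(\int_{B(x,r)}|f(y)|^p\,dy\right)^{1/p}<\infty.$$ The Stummel $p$-modulus of $f\in L^p_{\rm loc}(\mathbb{R}^n)$ is $$\eta_{p,\Psi}f(r):=\sup_{x\in\mathbb{R}^n}\left(\int_{|x-y|<r}\frac{|f(y)|^p\,\Psi(|x-y|)}{|x-y|^n}\,dy\right)^{1/p}\in[0,\infty],\quad r>0,$$ which is nondecreasing in $r$, and the generalized Stummel $p$-class is $S_{p,\Psi}=S_{p,\Psi}(\mathbb{R}^n):=\{f\in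 L^p_{\rm loc}(\mathbb{R}^n):\ \eta_{p,\Psi}f(r)\searrow 0 \text{ as } r\searrow 0\}$, i.e. $\lim_{r\to0^+}\eta_{p,\Psi}f(r)=0$. *)

theory Defs
  imports "HOL-Analysis.Analysis"
begin

text \<open>Euclidean n-space is \<open>real ^ 'n\<close>, with dimension \<open>CARD('n)\<close>.  Measurability and integration
  refer to Lebesgue measure; elements of the function spaces are functions, not a.e.-classes.\<close>

text \<open>A measurable function from \<open>(0,\<infinity>)\<close> to \<open>(0,\<infinity>)\<close>; values at arguments \<open>\<le> 0\<close> are irrelevant.\<close>

definition pos_measurable :: "(real \<Rightarrow> real) \<Rightarrow> bool" where
  "pos_measurable \<Psi> \<longleftrightarrow>
     \<Psi> \<in> borel_measurable (lebesgue_on {0<..}) \<and> (\<forall>r>0. \<Psi> r > 0)"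

text \<open>The power \<open>t \<mapsto> t\<^sup>a\<close> on \<open>[0,\<infinity>]\<close>, only used for exponents \<open>a > 0\<close>
  (hence the value \<open>\<infinity>\<close> at \<open>\<infinity>\<close>).\<close>

definition ennpowr :: "ennreal \<Rightarrow> real \<Rightarrow> ennreal" where
  "ennpowr t a = (if t = \<infinity> then \<infinity> else ennreal (enn2real t powr a))"

definition Lp_loc :: "real \<Rightarrow> (real ^ 'n::finite \<Rightarrow> real) set" where
  "Lp_loc p = {f. f \<in> borel_measurable lebesgue \<and>
     (\<forall>K. compact K \<longrightarrow> set_integrable lebesgue K (\<lambda>y. \<bar>f y\<bar> powr p))}"

definition morrey_norm :: "real \<Rightarrow> (real \<Rightarrow> real) \<Rightarrow> (real ^ 'n::finite \<Rightarrow> real) \<Rightarrow> ennreal" where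
  "morrey_norm p \<Psi> f =
     (SUP (x, r) \<in> UNIV \<times> {0<..}.
        ennreal (measure lebesgue (ball x r) powr (- 1 / p) / \<Psi> r) *
        ennpowr (\<integral>\<^sup>+ y \<in> ball x r. ennreal (\<bar>f y\<bar> powr p) \<partial>lebesgue) (1 / p))"

definition morrey_space :: "real \<Rightarrow> (real \<Rightarrow> real) \<Rightarrow> (real ^ 'n::finite \<Rightarrow> real) set" where
  "morrey_space p \<Psi> = {f \<in> Lp_loc p. morrey_norm p \<Psi> f < \<infinity>}"

text \<open>At \<open>y = x\<close> the integrand takes the value \<open>0\<close> by the convention \<open>a / 0 = 0\<close>;
  this concerns a single point, which is a null set.\<close>

definition stummel_modulus ::
  "real \<Rightarrow> (real \<Rightarrow> real) \<Rightarrow> (real ^ 'n::finite \<Rightarrow> real) \<Rightarrow> real \<Rightarrow> ennreal" where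
  "stummel_modulus p \<Psi> f r =
     (SUP x. ennpowr (\<integral>\<^sup>+ y \<in> {y. norm (x - y) < r}.
        ennreal (\<bar>f y\<bar> powr p * \<Psi> (norm (x - y)) / norm (x - y) ^ CARD('n)) \<partial>lebesgue) (1 / p))"

text \<open>The modulus is nondecreasing in \<open>r\<close>, so \<open>\<eta>(r) \<searrow> 0\<close> means just convergence to \<open>0\<close>.\<close>

definition stummel_class :: "real \<Rightarrow> (real \<Rightarrow> real) \<Rightarrow> (real ^ 'n::finite \<Rightarrow> real) set" where
  "stummel_class p \<Psi> = {f \<in> Lp_loc p. (stummel_modulus p \<Psi> f \<longlongrightarrow> 0) (at_right 0)}"

end

theory Submission
  imports Defs
begin

text \<open>Since \<open>\<Psi>\<^sub>1(s)/s\<^sup>n\<close> is almost decreasing, the singular weight in the Stummel integral over \<open>B(x,r)\<close>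
  is at least \<open>\<Psi>\<^sub>1(r)/(A r\<^sup>n)\<close>, so the bound on the modulus gives
  \<open>\<integral>\<^bsub>B(x,r)\<^esub> |f|\<^bsup>p1\<^esup> \<le> A c\<^bsup>p1\<^esup> r\<^sup>n \<Psi>\<^sub>2(r)\<^bsup>p1\<^esup>\<close>. The passage to the exponent \<open>p\<^sub>2\<close> needs no
  Hoelder inequality: \<open>t\<^bsup>p2\<^esup> \<le> M\<^bsup>p2\<^esup> + M\<^bsup>p2-p1\<^esup> t\<^bsup>p1\<^esup>\<close> with \<open>M = \<Psi>\<^sub>2(r)\<close> is scaled so that both terms,
  integrated over \<open>B(x,r)\<close>, are multiples of \<open>r\<^sup>n \<Psi>\<^sub>2(r)\<^bsup>p2\<^esup>\<close>.\<close>

text \<open>The maps \<open>t powr a\<close> and \<open>t powr (1 / a)\<close> are mutually inverse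
  and monotone, and a finite bound rules out \<open>t = \<infinity>\<close>. This strips the outer
  root from the modulus and from the Morrey norm.\<close>

lemma ennpowr_le_ennreal_iff:
  assumes "a > 0" "b \<ge> 0"
  shows "ennpowr t a \<le> ennreal b \<longleftrightarrow> t \<le> ennreal (b powr (1 / a))"
proof (cases t)
  case (real u)
  have "u powr a \<le> b \<longleftrightarrow> u \<le> b powr (1 / a)"
  proof
    assume "u powr a \<le> b"
    then have "(u powr a) powr (1 / a) \<le> b powr (1 / a)"
      using assms by (intro powr_mono2) auto
    then show "u \<le> b powr (1 / a)"
      using assms real by (simp add: powr_powr)
  next
    assume "u \<le> b powr (1 / a)"
    then have "u powr a \<le> (b powr (1 / a)) powr a"
      using assms real by (intro powr_mono2) auto
    then show "u powr a \<le> b"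
      using assms by (simp add: powr_powr)
  qed
  then show ?thesis
    using real assms by (simp add: ennpowr_def)
next
  case top
  then show ?thesis by (simp add: ennpowr_def top_unique)
qed

text \<open>Below the threshold \<open>M\<close> the first term dominates; above it,
  \<open>t powr (q - p)\<close> has a nonpositive exponent and is at most
  \<open>M powr (q - p)\<close>.\<close>

lemma powr_le_powr_add_scaled_powr:
  fixes t M p q :: real
  assumes "0 \<le> t" "0 < M" "0 \<le> q" "q \<le> p"
  shows "t powr q \<le> M powr q + M powr (q - p) * t powr p"
proof (cases "t \<le> M")
  case True
  then have "t powr q \<le> M powr q"
    using assms by (intro powr_mono2) auto
  then show ?thesis by (simp add: add_increasing2)
next
  case False
  then have "t powr (q - p) \<le> M powr (q - p)"
    using assms by (intro powr_mono2') auto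
  then have "t powr (q - p) * t powr p \<le> M powr (q - p) * t powr p"
    by (intro mult_right_mono) auto
  moreover have "t powr (q - p) * t powr p = t powr q"
    by (simp flip: powr_add)
  ultimately show ?thesis by (simp add: add_increasing)
qed

text \<open>Splitting at threshold 1 dominates the \<open>q\<close>-th power by
  \<open>1 + \<bar>f y\<bar> powr p\<close>, and constants are integrable on compact sets.\<close>

lemma Lp_loc_antimono:
  assumes "1 \<le> q" "q \<le> p"
  shows "Lp_loc p \<subseteq> (Lp_loc q :: (real ^ 'n::finite \<Rightarrow> real) set)"
proof
  fix f :: "real ^ 'n \<Rightarrow> real"
  assume f: "f \<in> Lp_loc p"
  then have [measurable]: "f \<in> borel_measurable lebesgue"
    by (simp add: Lp_loc_def)
  have "set_integrable lebesgue K (\<lambda>y. \<bar>f y\<bar> powr q)" if K: "compact K" for K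
  proof -
    have [measurable]: "K \<in> sets lebesgue"
      using K lmeasurable_compact by blast
    have "set_integrable lebesgue K (\<lambda>y. \<bar>f y\<bar> powr p)"
      using f K by (simp add: Lp_loc_def)
    moreover have "set_integrable lebesgue K (\<lambda>y. 1::real)"
      using lmeasurable_compact[OF K] by (simp add: set_integrable_def lmeasurable_iff_integrable)
    ultimately have "set_integrable lebesgue K (\<lambda>y. 1 + \<bar>f y\<bar> powr p)"
      by (intro set_integral_add)
    then show ?thesis
    proof (rule set_integrable_bound)
      show "set_borel_measurable lebesgue K (\<lambda>y. \<bar>f y\<bar> powr q)"
        unfolding set_borel_measurable_def by measurable
      show "AE y in lebesgue. y \<in> K \<longrightarrow> norm (\<bar>f y\<bar> powr q) \<le> norm (1 + \<bar>f y\<bar> powr p)"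
        using powr_le_powr_add_scaled_powr[of "\<bar>f _\<bar>" 1 q p] assms by auto
    qed
  qed
  then show "f \<in> Lp_loc q"
    by (simp add: Lp_loc_def)
qed

text \<open>Integrating the splitting at threshold \<open>m\<close> yields
  \<open>V * m powr q\<close> and \<open>m powr (q - p) * (B * m powr p)\<close>; both scale like
  \<open>m powr q\<close>.\<close>

lemma set_nn_integral_powr_le_scaled:
  assumes [measurable]: "f \<in> borel_measurable M" "S \<in> sets M"
    and "emeasure M S = ennreal V" "0 \<le> V" "0 < m" "0 \<le> q" "q \<le> p" "0 \<le> B"
    and bound: "(\<integral>\<^sup>+ y \<in> S. ennreal (\<bar>f y\<bar> powr p) \<partial>M) \<le> ennreal (B * m powr p)"
  shows "(\<integral>\<^sup>+ y \<in> S. ennreal (\<bar>f y\<bar> powr q) \<partial>M) \<le> ennreal ((V + B) * m powr q)"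
proof -
  have "(\<integral>\<^sup>+ y \<in> S. ennreal (\<bar>f y\<bar> powr q) \<partial>M)
      \<le> (\<integral>\<^sup>+ y. ennreal (m powr q) * indicator S y
            + ennreal (m powr (q - p)) * (ennreal (\<bar>f y\<bar> powr p) * indicator S y) \<partial>M)"
  proof (rule nn_integral_mono)
    fix y
    show "ennreal (\<bar>f y\<bar> powr q) * indicator S y \<le> ennreal (m powr q) * indicator S y
        + ennreal (m powr (q - p)) * (ennreal (\<bar>f y\<bar> powr p) * indicator S y)"
      using powr_le_powr_add_scaled_powr[of "\<bar>f y\<bar>" m q p] assms
      by (auto simp: indicator_def simp flip: ennreal_mult ennreal_plus intro!: ennreal_leI)
  qed
  also have "\<dots> = ennreal (m powr q) * emeasure M S
      + ennreal (m powr (q - p)) * (\<integral>\<^sup>+ y \<in> S. ennreal (\<bar>f y\<bar> powr p) \<partial>M)"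
    by (simp add: nn_integral_add nn_integral_cmult)
  also have "\<dots> \<le> ennreal (m powr q) * ennreal V + ennreal (m powr (q - p)) * ennreal (B * m powr p)"
    using assms(3) bound by (intro add_mono mult_left_mono) auto
  also have "\<dots> = ennreal (m powr q * V + m powr (q - p) * (B * m powr p))"
    using assms by (simp flip: ennreal_mult ennreal_plus)
  also have "m powr q * V + m powr (q - p) * (B * m powr p) = (V + B) * m powr q"
    using \<open>0 < m\<close> by (simp add: powr_diff field_simps)
  finally show ?thesis .
qed

lemma nn_integral_ball_le_stummel_modulus:
  fixes f :: "real ^ 'n::finite \<Rightarrow> real"
  assumes [measurable]: "f \<in> borel_measurable lebesgue"
    and "p > 0" "A > 0" "r > 0" "\<Psi> r > 0" "b \<ge> 0"
    and decr: "\<And>s. 0 < s \<Longrightarrow> s \<le> r \<Longrightarrow> \<Psi> r / r ^ CARD('n) \<le> A * (\<Psi> s / s ^ CARD('n))"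
    and modulus: "stummel_modulus p \<Psi> f r \<le> ennreal b"
  shows "(\<integral>\<^sup>+ y \<in> ball x r. ennreal (\<bar>f y\<bar> powr p) \<partial>lebesgue)
           \<le> ennreal (A * r ^ CARD('n) / \<Psi> r * b powr p)"
    (is "?I \<le> _")
proof -
  \<comment> \<open>The lower bound for the weight \<open>\<Psi> s / s ^ CARD('n)\<close> on
    \<open>0 < s \<le> r\<close>, obtained by dividing \<open>decr\<close> by
    \<open>A\<close>.\<close>
  define k where "k = \<Psi> r / (A * r ^ CARD('n))"
  have k: "k > 0"
    using assms by (simp add: k_def)
  have [measurable]: "ball x r \<in> sets lebesgue"
    by simp
  let ?w = "\<lambda>y. \<bar>f y\<bar> powr p * \<Psi> (norm (x - y)) / norm (x - y) ^ CARD('n)"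
  let ?J = "\<integral>\<^sup>+ y \<in> {y. norm (x - y) < r}. ennreal (?w y) \<partial>lebesgue"
  have "ennpowr ?J (1 / p) \<le> stummel_modulus p \<Psi> f r"
    unfolding stummel_modulus_def by (rule SUP_upper) simp
  then have "ennpowr ?J (1 / p) \<le> ennreal b"
    using modulus by (rule order_trans)
  then have J: "?J \<le> ennreal (b powr p)"
    using \<open>p > 0\<close> \<open>b \<ge> 0\<close> by (simp add: ennpowr_le_ennreal_iff)
  have weight: "k \<le> \<Psi> s / s ^ CARD('n)" if "0 < s" "s \<le> r" for s
  proof -
    have "k = \<Psi> r / r ^ CARD('n) / A"
      by (simp add: k_def mult.commute)
    also have "\<dots> \<le> \<Psi> s / s ^ CARD('n)"
      using decr[OF that] \<open>A > 0\<close> by (subst pos_divide_le_eq) (simp_all add: mult.commute)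
    finally show ?thesis .
  qed
  have "ennreal k * ?I = (\<integral>\<^sup>+ y. ennreal k * (ennreal (\<bar>f y\<bar> powr p) * indicator (ball x r) y) \<partial>lebesgue)"
    by (rule nn_integral_cmult[symmetric]) measurable
  also have "\<dots> \<le> ?J"
  proof (rule nn_integral_mono_AE)
    \<comment> \<open>The centre must be left out: division by zero makes the weight 0 there, so the
      bound by \<open>k\<close> fails.\<close>
    have "AE y in lebesgue. y \<noteq> x"
      by (rule AE_I'[of "{x}"]) (auto simp: null_sets_completionI)
    then show "AE y in lebesgue. ennreal k * (ennreal (\<bar>f y\<bar> powr p) * indicator (ball x r) y)
        \<le> ennreal (?w y) * indicator {y. norm (x - y) < r} y"
    proof eventually_elim
      case (elim y)
      show ?case
      proof (cases "norm (x - y) < r")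
        case True
        then have "k * \<bar>f y\<bar> powr p \<le> \<Psi> (norm (x - y)) / norm (x - y) ^ CARD('n) * \<bar>f y\<bar> powr p"
          using elim by (intro mult_right_mono weight) auto
        then have "ennreal k * ennreal (\<bar>f y\<bar> powr p) \<le> ennreal (?w y)"
          using k by (simp add: mult.commute ennreal_leI flip: ennreal_mult)
        then show ?thesis
          using True by (simp add: dist_norm)
      qed (simp add: dist_norm)
    qed
  qed
  also note J
  finally have "ennreal (1 / k) * (ennreal k * ?I) \<le> ennreal (1 / k) * ennreal (b powr p)"
    by (intro mult_left_mono) auto
  moreover have "ennreal (1 / k) * (ennreal k * ?I) = ?I"
    using k by (simp flip: mult.assoc ennreal_mult)
  moreover have "ennreal (1 / k) * ennreal (b powr p) = ennreal (A * r ^ CARD('n) / \<Psi> r * b powr p)"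
    using \<open>A > 0\<close> \<open>r > 0\<close> \<open>\<Psi> r > 0\<close> by (simp add: k_def flip: ennreal_mult)
  ultimately show ?thesis
    by simp
qed

theorem theorem4p5:
  fixes p1 p2 A c :: real
    and \<Psi>1 \<Psi>2 :: "real \<Rightarrow> real"
    and f :: "real ^ 'n::finite \<Rightarrow> real"
  assumes "1 \<le> p2" and "p2 \<le> p1"
    and "pos_measurable \<Psi>1"
    and "A > 0"
    and "\<And>s r. 0 < s \<Longrightarrow> s \<le> r \<Longrightarrow> \<Psi>1 r / r ^ CARD('n) \<le> A * (\<Psi>1 s / s ^ CARD('n))"
    and "f \<in> stummel_class p1 \<Psi>1"
    and "pos_measurable \<Psi>2"
    and "c > 0"
    and "\<And>r. r > 0 \<Longrightarrow> stummel_modulus p1 \<Psi>1 f r \<le> ennreal (c * \<Psi>1 r powr (1 / p1) * \<Psi>2 r)"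
  shows "f \<in> morrey_space p2 \<Psi>2"
proof -
  have f: "f \<in> Lp_loc p1"
    using assms(6) by (simp add: stummel_class_def)
  then have [measurable]: "f \<in> borel_measurable lebesgue"
    by (simp add: Lp_loc_def)
  define v where "v = unit_ball_vol (real CARD('n))"
  have v: "v > 0"
    by (simp add: v_def)
  \<comment> \<open>Chosen so that \<open>V + A * c powr p1 * r ^ CARD('n) = D * V\<close> for the
    ball volume \<open>V = v * r ^ CARD('n)\<close>; it depends on neither \<open>x\<close> nor
    \<open>r\<close>.\<close>
  define D where "D = (v + A * c powr p1) / v"
  have D: "D > 0"
    using v assms by (simp add: D_def add_pos_nonneg)
  have "ennreal (measure lebesgue (ball x r) powr (- 1 / p2) / \<Psi>2 r) *
      ennpowr (\<integral>\<^sup>+ y \<in> ball x r. ennreal (\<bar>f y\<bar> powr p2) \<partial>lebesgue) (1 / p2)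
    \<le> ennreal (D powr (1 / p2))" if r: "r > 0" for x :: "real ^ 'n" and r
  proof -
    have \<Psi>: "\<Psi>1 r > 0" "\<Psi>2 r > 0"
      using assms(3,7) r by (auto simp: pos_measurable_def)
    define V where "V = v * r ^ CARD('n)"
    have V: "V > 0"
      using v r by (simp add: V_def)
    have vol: "measure lebesgue (ball x r) = V"
      using r by (simp add: V_def v_def content_ball)
    have em: "emeasure lebesgue (ball x r) = ennreal V"
      using r by (simp add: V_def v_def emeasure_ball)
    have "(\<integral>\<^sup>+ y \<in> ball x r. ennreal (\<bar>f y\<bar> powr p1) \<partial>lebesgue)
        \<le> ennreal (A * r ^ CARD('n) / \<Psi>1 r * (c * \<Psi>1 r powr (1 / p1) * \<Psi>2 r) powr p1)"
      using assms r \<Psi> by (intro nn_integral_ball_le_stummel_modulus) auto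
    \<comment> \<open>The power \<open>p1\<close> undoes the root of \<open>\<Psi>1 r\<close>, which
      then cancels the denominator.\<close>
    also have "A * r ^ CARD('n) / \<Psi>1 r * (c * \<Psi>1 r powr (1 / p1) * \<Psi>2 r) powr p1
        = (A * c powr p1 * r ^ CARD('n)) * \<Psi>2 r powr p1"
      using assms(1,2,8) \<Psi> by (simp add: powr_mult powr_powr)
    \<comment> \<open>Here the threshold is \<open>\<Psi>2 r\<close> and \<open>B\<close> is
      \<open>A * c powr p1 * r ^ CARD('n)\<close>.\<close>
    finally have "(\<integral>\<^sup>+ y \<in> ball x r. ennreal (\<bar>f y\<bar> powr p2) \<partial>lebesgue)
        \<le> ennreal ((V + A * c powr p1 * r ^ CARD('n)) * \<Psi>2 r powr p2)"
      using assms(1,2,4) r \<Psi> V em by (intro set_nn_integral_powr_le_scaled) auto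
    \<comment> \<open>Written as an exact \<open>p2\<close>-th power, so that the root can be taken
      by \<open>ennpowr_le_ennreal_iff\<close>.\<close>
    also have "(V + A * c powr p1 * r ^ CARD('n)) * \<Psi>2 r powr p2
        = ((D * V) powr (1 / p2) * \<Psi>2 r) powr p2"
      using assms(1) v r \<Psi> D V by (simp add: powr_mult powr_powr) (simp add: D_def V_def field_simps)
    finally have "ennpowr (\<integral>\<^sup>+ y \<in> ball x r. ennreal (\<bar>f y\<bar> powr p2) \<partial>lebesgue) (1 / p2)
        \<le> ennreal ((D * V) powr (1 / p2) * \<Psi>2 r)"
      using assms(1) \<Psi> by (simp add: ennpowr_le_ennreal_iff)
    then have "ennreal (V powr (- 1 / p2) / \<Psi>2 r) *
        ennpowr (\<integral>\<^sup>+ y \<in> ball x r. ennreal (\<bar>f y\<bar> powr p2) \<partial>lebesgue) (1 / p2)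
        \<le> ennreal (V powr (- 1 / p2) / \<Psi>2 r) * ennreal ((D * V) powr (1 / p2) * \<Psi>2 r)"
      by (intro mult_left_mono) auto
    also have "\<dots> = ennreal (V powr (- 1 / p2) / \<Psi>2 r * ((D * V) powr (1 / p2) * \<Psi>2 r))"
      using \<Psi> by (simp flip: ennreal_mult)
    \<comment> \<open>The normalising factor cancels both \<open>V\<close> and
      \<open>\<Psi>2 r\<close>, which leaves a bound uniform over all balls.\<close>
    also have "V powr (- 1 / p2) / \<Psi>2 r * ((D * V) powr (1 / p2) * \<Psi>2 r) = D powr (1 / p2)"
      using D V \<Psi> by (simp add: powr_mult powr_minus field_simps)
    finally show ?thesis
      by (simp add: vol)
  qed
  then have "morrey_norm p2 \<Psi>2 f \<le> ennreal (D powr (1 / p2))"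
    unfolding morrey_norm_def by (intro SUP_least) auto
  then have "morrey_norm p2 \<Psi>2 f < \<infinity>"
    by (simp add: le_less_trans)
  moreover have "f \<in> Lp_loc p2"
    using f Lp_loc_antimono[OF assms(1,2)] by blast
  ultimately show ?thesis
    by (simp add: morrey_space_def)
qed

end
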